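(* Let $R$ be a commutative ring with identity with Krull dimension $\dim(R)\geq 1$. If $R$ is a Jacobson ring, then $R$ is not a sober ring.
   Context: $\operatorname{Spec}(R)$ denotes the set of all prime ideals of $R$ and $\operatorname{Max}(R)$ the set of all maximal ideals of $R$. The Krull dimension $\dim(R)$ is the supremum of the lengths $k$ of finite strictly ascending chains $P_0\subset P_1\subset\cdots\subset P_k$ of prime ideals of $R$. A commutative ring $R$ is called a Jacobson ring if every prime ideal of $R$ is an intersection of maximal ideals of $R$. A commutative ring $R$ with identity is called a sober ring if for every $P\in\operatorname{Spec}(R)$ with $P\notin\operatorname{Max}(R)$ one has \[ P\neq \bigcap_{Q\in\operatorname{Spec}(R),\ P\subsetneq Q} Q . \] (This is a condition on the ideals of the ring; it is not the topological notion of a sober space.) *)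

theory Defs
  imports "HOL-Algebra.Ideal" "HOL-Library.Extended_Nat"
begin

definition prime_spec :: "('a, 'b) ring_scheme \<Rightarrow> 'a set set" where
  "prime_spec R = {P. primeideal P R}"

definition max_spec :: "('a, 'b) ring_scheme \<Rightarrow> 'a set set" where
  "max_spec R = {M. maximalideal M R}"

definition prime_chain :: "('a, 'b) ring_scheme \<Rightarrow> nat \<Rightarrow> (nat \<Rightarrow> 'a set) \<Rightarrow> bool" where
  "prime_chain R k P \<longleftrightarrow> (\<forall>i\<le>k. P i \<in> prime_spec R) \<and> (\<forall>i<k. P i \<subset> P (Suc i))"

(* The zero ring has no prime ideals; its dimension is 0 here, being the supremum of the
   empty set in enat. *)
definition krull_dim :: "('a, 'b) ring_scheme \<Rightarrow> enat" where
  "krull_dim R = Sup {enat k | k. \<exists>P. prime_chain R k P}"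

(* The empty intersection is UNIV in HOL, not carrier R. This makes no difference below:
   prime ideals are proper subsets of the carrier, so neither UNIV nor carrier R is one. *)
definition jacobson_ring :: "('a, 'b) ring_scheme \<Rightarrow> bool" where
  "jacobson_ring R \<longleftrightarrow> (\<forall>P \<in> prime_spec R. \<exists>\<M> \<subseteq> max_spec R. P = \<Inter>\<M>)"

definition sober_ring :: "('a, 'b) ring_scheme \<Rightarrow> bool" where
  "sober_ring R \<longleftrightarrow>
     (\<forall>P \<in> prime_spec R. P \<notin> max_spec R \<longrightarrow> P \<noteq> \<Inter>{Q \<in> prime_spec R. P \<subset> Q})"

end

theory Submission imports Defs begin

text \<open>Positive dimension provides a prime P strictly below another prime, so P is not maximal
  (\<open>not_maximal_if_psubset_prime\<close>). The Jacobson property writes P as an intersection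
  of maximal ideals. Each of them is prime and lies strictly above P, so intersecting all primes
  strictly above P already gives P, which soberness forbids.\<close>

lemma krull_dim_ge_oneE:
  assumes "krull_dim R \<ge> 1"
  obtains P Q where "P \<in> prime_spec R" "Q \<in> prime_spec R" "P \<subset> Q"
proof -
  \<comment> \<open>In strict form, \<open>less_Sup_iff\<close> yields a chain of positive length
    without asking whether the supremum is attained.\<close>
  have "0 < krull_dim R"
    using assms by (metis i0_lb iless_eSuc0 not_le one_eSuc order_le_less zero_neq_one)
  then obtain k C where "0 < k" and C: "prime_chain R k C"
    unfolding krull_dim_def less_Sup_iff by (auto simp: zero_enat_def)
  then have "C 0 \<in> prime_spec R" "C 1 \<in> prime_spec R" "C 0 \<subset> C 1"
    by (auto simp: prime_chain_def)
  then show thesis by (rule that)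
qed

lemma not_maximal_if_psubset_prime:
  assumes "Q \<in> prime_spec R" "P \<subset> Q"
  shows "P \<notin> max_spec R"
proof
  assume "P \<in> max_spec R"
  then interpret P: maximalideal P R by (simp add: max_spec_def)
  interpret Q: primeideal Q R using assms(1) by (simp add: prime_spec_def)
  have "Q = P \<or> Q = carrier R"
    using assms(2) Q.a_subset by (intro P.I_maximal Q.is_ideal) auto
  then show False using assms(2) Q.I_notcarr by auto
qed

lemma max_spec_subset_prime_spec:
  assumes "cring R"
  shows "max_spec R \<subseteq> prime_spec R"
  using cring.maximalideal_prime[OF assms] by (auto simp: max_spec_def prime_spec_def)

theorem proposition2p9:
  fixes R :: "('a, 'b) ring_scheme"
  assumes "cring R"
    and "krull_dim R \<ge> 1"
    and "jacobson_ring R"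
  shows "\<not> sober_ring R"
proof -
  obtain P Q where P: "P \<in> prime_spec R" and "Q \<in> prime_spec R" "P \<subset> Q"
    using assms(2) by (rule krull_dim_ge_oneE)
  then have nmax: "P \<notin> max_spec R" by (intro not_maximal_if_psubset_prime)
  obtain \<M> where \<M>: "\<M> \<subseteq> max_spec R" "P = \<Inter>\<M>"
    using assms(3) P by (auto simp: jacobson_ring_def)
  \<comment> \<open>Members of \<open>\<M>\<close> contain its intersection P, and none equals P
    because they are maximal and P is not.\<close>
  then have "\<M> \<subseteq> {Q \<in> prime_spec R. P \<subset> Q}"
    using nmax max_spec_subset_prime_spec[OF assms(1)] by blast
  \<comment> \<open>A squeeze: the larger family has the smaller intersection, yet all its members
    contain P. An empty \<open>\<M>\<close> needs no separate case.\<close>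
  then have "P = \<Inter>{Q \<in> prime_spec R. P \<subset> Q}"
    using \<M>(2) by blast
  then show ?thesis
    using P nmax by (auto simp: sober_ring_def)
qed

end
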